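(* Let $d\in\mathbb{N}$, $\varepsilon>0$, and let $\bigsqcup_{n\in\mathbb{N}}\Gamma_n$ be a $(d,\varepsilon)$-expander with unbounded girth. Then there exists a set $\mathcal{N}$ of $2^{\aleph_0}$ infinite subsets of $\mathbb{N}$ such that for all $M,N\in\mathcal{N}$ with $M\neq N$ there is no regular map $\bigsqcup_{n\in M}\Gamma_n\to\bigsqcup_{n\in N}\Gamma_n$.
   Context: Graphs are simple and undirected; $|\Gamma|$ is the number of vertices of $\Gamma$. For a finite graph $\Gamma$ with $n\ge 2$ vertices and $A\subseteq V(\Gamma)$, the vertex boundary $\partial A$ is the set of vertices of $V(\Gamma)\setminus A$ having a neighbour in $A$, and the (vertex) Cheeger constant is $h(\Gamma)=\min\{|\partial A|/|A| : \emptyset\neq A\subseteq V(\Gamma),\ |A|\le n/2\}$. An $\varepsilon$-expander is an infinite (disjoint) union $\bigsqcup_{n\in\mathbb{N}}\Gamma_n$ of distinct (pairwise non-isomorphic) finite graphs $\Gamma_n$, each with at least two vertices, with $h(\Gamma_n)\ge\varepsilon>0$ for all $n$. It is a $(d,\varepsilon)$-expander if moreover every vertex has degree at most $d$. Each component carries the shortest path metric, and vertices in different components are at infinite distance. The girth $g(\Gamma)$ is the length of the shortest simple cycle of positive length in $\Gamma$ ($\infty$ if there is none). $\bigsqcup_{n\in\mathbb{N}}\Gamma_n$ has unbounded girth if $g(\Gamma_n)\to\infty$ as $n\to\infty$. A map $\phi:VX\to VX'$ between the vertex sets of two graphs is regular if it is Lipschitz (there is $K$ such that $d(\phi(x),\phi(y))\le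 K\,d(x,y)$ for all $x,y$ in the same component of $X$) and pre-images of vertices have uniformly bounded cardinality. "A regular map $X\to X'$" means a regular map $VX\to VX'$. *)

theory Defs
  imports Graph_Theory.Graph_Theory "HOL-Library.Extended_Nat" "HOL-Library.Extended_Real"
    "HOL-Library.Equipollence"
begin

text \<open>
  A finite simple undirected graph is a digraph satisfying the locale predicate \<^locale>\<open>graph\<close>
  (finite, no loops, no parallel arcs, symmetric): every undirected edge is represented by its
  two orientations.
\<close>

definition vertex_boundary :: "('a, 'b) pre_digraph \<Rightarrow> 'a set \<Rightarrow> 'a set" where
  "vertex_boundary G A = {v \<in> verts G - A. \<exists>u\<in>A. u \<rightarrow>\<^bsub>G\<^esub> v}"

definition cheeger_constant :: "('a, 'b) pre_digraph \<Rightarrow> real" where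
  "cheeger_constant G =
     Min {real (card (vertex_boundary G A)) / real (card A) | A.
            A \<subseteq> verts G \<and> A \<noteq> {} \<and> real (card A) \<le> real (card (verts G)) / 2}"

text \<open>
  In a symmetric digraph, \<^const>\<open>pre_digraph.cycle\<close> also holds of the closed walk that traverses an
  edge forth and back; requiring length at least 3 excludes exactly these.
  The infimum of the empty set is \<open>\<infinity>\<close>.
\<close>
definition girth :: "('a, 'b) pre_digraph \<Rightarrow> enat" where
  "girth G = (INF p \<in> {p. pre_digraph.cycle G p \<and> 3 \<le> length p}. enat (length p))"

definition unbounded_girth :: "(nat \<Rightarrow> ('a, 'b) pre_digraph) \<Rightarrow> bool" where
  "unbounded_girth \<Gamma> \<longleftrightarrow> ((\<lambda>n. girth (\<Gamma> n)) \<longlonglongrightarrow> \<infinity>)"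

definition expander :: "real \<Rightarrow> (nat \<Rightarrow> ('a, 'b) pre_digraph) \<Rightarrow> bool" where
  "expander \<epsilon> \<Gamma> \<longleftrightarrow>
     0 < \<epsilon> \<and>
     (\<forall>n. graph (\<Gamma> n) \<and> 2 \<le> card (verts (\<Gamma> n)) \<and> \<epsilon> \<le> cheeger_constant (\<Gamma> n)) \<and>
     (\<forall>m n. m \<noteq> n \<longrightarrow> \<not> digraph_iso (\<Gamma> m) (\<Gamma> n))"

text \<open>In a simple graph the out-degree of a vertex is its number of neighbours.\<close>
definition bounded_degree_expander :: "nat \<Rightarrow> real \<Rightarrow> (nat \<Rightarrow> ('a, 'b) pre_digraph) \<Rightarrow> bool" where
  "bounded_degree_expander d \<epsilon> \<Gamma> \<longleftrightarrow>
     expander \<epsilon> \<Gamma> \<and> (\<forall>n. \<forall>v \<in> verts (\<Gamma> n). out_degree (\<Gamma> n) v \<le> d)"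

definition disjoint_union ::
    "nat set \<Rightarrow> (nat \<Rightarrow> ('a, 'b) pre_digraph) \<Rightarrow> (nat \<times> 'a, nat \<times> 'b) pre_digraph" where
  "disjoint_union I \<Gamma> =
     \<lparr> verts = (SIGMA n:I. verts (\<Gamma> n)), arcs = (SIGMA n:I. arcs (\<Gamma> n)),
       tail = (\<lambda>(n, e). (n, tail (\<Gamma> n) e)), head = (\<lambda>(n, e). (n, head (\<Gamma> n) e)) \<rparr>"

text \<open>
  \<^const>\<open>wf_digraph.\<mu>\<close> is specified only for well-formed digraphs, hence the following lemma.
\<close>
lemma wf_digraph_disjoint_union:
  assumes "\<And>n. n \<in> I \<Longrightarrow> wf_digraph (\<Gamma> n)"
  shows "wf_digraph (disjoint_union I \<Gamma>)"
  using assms by (auto simp: wf_digraph_def disjoint_union_def)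

text \<open>The shortest path metric; it is \<open>\<infinity>\<close> between different connected components.\<close>
definition graph_dist :: "('a, 'b) pre_digraph \<Rightarrow> 'a \<Rightarrow> 'a \<Rightarrow> ereal" where
  "graph_dist G u v = wf_digraph.\<mu> G (\<lambda>_. 1) u v"

lemma graph_dist_eq_length:
  assumes "wf_digraph G"
  shows "graph_dist G u v = (INF p \<in> {p. pre_digraph.awalk G u p v}. ereal (real (length p)))"
proof -
  have "wf_digraph.awalk_cost (\<lambda>_. 1) p = real (length p)" for p :: "'b awalk"
    by (simp add: wf_digraph.awalk_cost_def[OF assms] sum_list_triv)
  then show ?thesis
    by (simp add: graph_dist_def wf_digraph.\<mu>_def[OF assms])
qed

definition regular_map ::
    "('a, 'b) pre_digraph \<Rightarrow> ('c, 'd) pre_digraph \<Rightarrow> ('a \<Rightarrow> 'c) \<Rightarrow> bool" where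
  "regular_map X Y \<phi> \<longleftrightarrow>
     \<phi> \<in> verts X \<rightarrow> verts Y \<and>
     (\<exists>K::real. \<forall>x \<in> verts X. \<forall>y \<in> verts X. x \<rightarrow>\<^sup>*\<^bsub>X\<^esub> y \<longrightarrow>
        graph_dist Y (\<phi> x) (\<phi> y) \<le> ereal K * graph_dist X x y) \<and>
     (\<exists>m::nat. \<forall>z \<in> verts Y. finite {x \<in> verts X. \<phi> x = z} \<and> card {x \<in> verts X. \<phi> x = z} \<le> m)"

end

theory Submission
  imports Defs
begin

text \<open>
  Pass to a subsequence along which both the order and the girth of each graph dwarf the size of
  all earlier ones, and choose continuum many index sets that differ pairwise in infinitely many
  places in both directions. If \<open>i\<close> lies in the first set only, a regular map sends the connected
  graph \<open>\<Gamma>\<^sub>i\<close> into a single \<open>\<Gamma>\<^sub>j\<close> with \<open>j \<noteq> i\<close>. For \<open>j < i\<close> the fibres are too large. For \<open>j > i\<close> the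
  image lies in a ball of \<open>\<Gamma>\<^sub>j\<close> that is a tree because of the girth; the preimage of a
  suitable branch of this tree is a fixed proportion of \<open>\<Gamma>\<^sub>i\<close>, but has bounded boundary, since an
  edge of \<open>\<Gamma>\<^sub>i\<close> leaving it must be mapped near the root of the branch. This contradicts expansion.
\<close>

section \<open>Short cycles in an edge relation\<close>

text \<open>Cycles are index functions over a bare edge relation, so that the tree arguments can
  work with \<open>^^\<close> instead of lists of arcs.\<close>

definition acyclic_upto :: "nat \<Rightarrow> ('a \<times> 'a) set \<Rightarrow> bool" where
  "acyclic_upto L E \<longleftrightarrow>
     \<not> (\<exists>n x. 3 \<le> n \<and> n \<le> L \<and> x n = x 0 \<and> inj_on x {..<n} \<and> (\<forall>i<n. (x i, x (Suc i)) \<in> E))"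

text \<open>A shortest return \<open>x (i + k) = x i\<close> is a simple closed walk:
  \<open>k = 1\<close> would be a loop and \<open>k = 2\<close> a backtrack. Backtracking where the
  walk closes up is allowed, because two paths from the root may begin with the same edge.\<close>

lemma nonbacktracking_closed_walk_contains_cycle:
  assumes "irrefl E" and walk: "\<And>i. i < m \<Longrightarrow> (x i, x (Suc i)) \<in> E"
    and nonback: "\<And>i. i + 2 \<le> m \<Longrightarrow> x i \<noteq> x (i + 2)"
    and "x m = x 0" "0 < m" "m \<le> L"
  shows "\<not> acyclic_upto L E"
proof -
  define P where "P k \<longleftrightarrow> 0 < k \<and> (\<exists>i. i + k \<le> m \<and> x (i + k) = x i)" for k
  have "P m"
    using assms by (auto simp: P_def)
  define k where "k = (LEAST k. P k)"
  have "P k"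
    unfolding k_def using \<open>P m\<close> by (rule LeastI)
  have least: "k \<le> j" if "P j" for j
    unfolding k_def using that by (rule Least_le)
  from \<open>P k\<close> obtain i where i: "0 < k" "i + k \<le> m" "x (i + k) = x i"
    by (auto simp: P_def)
  have "k \<noteq> 1"
    using walk[of i] i \<open>irrefl E\<close> by (auto simp: irrefl_def)
  moreover have "k \<noteq> 2"
    using nonback[of i] i by auto
  ultimately have "3 \<le> k"
    using i by linarith
  have neq: "x (i + a) \<noteq> x (i + b)" if "a < b" "b < k" for a b
  proof
    assume "x (i + a) = x (i + b)"
    then have "P (b - a)"
      using that i by (auto simp: P_def intro!: exI[of _ "i + a"])
    then show False
      using least[of "b - a"] that by linarith
  qed
  have "inj_on (\<lambda>j. x (i + j)) {..<k}"
    using neq by (auto intro!: linorder_inj_onI)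
  moreover have "\<forall>j<k. (x (i + j), x (i + Suc j)) \<in> E"
    using walk i by auto
  ultimately show ?thesis
    using \<open>3 \<le> k\<close> i \<open>m \<le> L\<close> unfolding acyclic_upto_def
    by (auto intro!: exI[of _ k] exI[of _ "\<lambda>j. x (i + j)"])
qed

section \<open>Depth, parents and branches in a ball without short cycles\<close>

text \<open>Two walks of length at most \<open>R\<close> from \<open>r\<close> to neighbours of a
  common vertex, joined by the two edges at that vertex, close up to a walk of length at most
  \<open>2 * R + 2\<close>.\<close>

locale tree_like_ball =
  fixes E :: "('a \<times> 'a) set" and r :: 'a and R :: nat
  assumes symE: "sym E" and irreflE: "irrefl E" and acyc: "acyclic_upto (2 * R + 2) E"
begin

text \<open>The distance from \<open>r\<close>. The value is meaningful only for vertices reachable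
  from \<open>r\<close>, hence the reachability premises below.\<close>

definition depth :: "'a \<Rightarrow> nat" where
  "depth u = (LEAST k. (r, u) \<in> E ^^ k)"

lemma depth_le: "(r, u) \<in> E ^^ k \<Longrightarrow> depth u \<le> k"
  unfolding depth_def by (rule Least_le)

lemma depth_walk: "(r, u) \<in> E\<^sup>* \<Longrightarrow> (r, u) \<in> E ^^ depth u"
  unfolding depth_def by (auto simp: rtrancl_power intro: LeastI)

lemma depth_root [simp]: "depth r = 0"
  using depth_le[of r 0] by simp

lemma depth_eq_0: "(r, u) \<in> E\<^sup>* \<Longrightarrow> depth u = 0 \<Longrightarrow> u = r"
  using depth_walk[of u] by simp

lemma depth_relpow: "(r, u) \<in> E\<^sup>* \<Longrightarrow> (u, v) \<in> E ^^ k \<Longrightarrow> depth v \<le> depth u + k"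
  by (meson depth_le depth_walk relpow_trans)

lemma depth_step: "(r, u) \<in> E\<^sup>* \<Longrightarrow> (u, v) \<in> E \<Longrightarrow> depth v \<le> Suc (depth u)"
  using depth_relpow[of u v 1] by simp

text \<open>For \<open>u \<noteq> r\<close> in the ball the choice is unique, by
  \<open>lower_neighbour_unique\<close>.\<close>

definition parent :: "'a \<Rightarrow> 'a" where
  "parent u = (SOME w. (r, w) \<in> E\<^sup>* \<and> (u, w) \<in> E \<and> Suc (depth w) = depth u)"

text \<open>The last vertex before \<open>u\<close> on a shortest walk from \<open>r\<close> is a
  witness for the choice in \<open>parent\<close>.\<close>

lemma parent:
  assumes "(r, u) \<in> E\<^sup>*" "u \<noteq> r"
  shows "(r, parent u) \<in> E\<^sup>*" "(u, parent u) \<in> E" "Suc (depth (parent u)) = depth u"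
proof -
  have "depth u \<noteq> 0"
    using assms depth_eq_0 by blast
  then obtain k where k: "depth u = Suc k"
    using not0_implies_Suc by blast
  then obtain w where w: "(r, w) \<in> E ^^ k" "(w, u) \<in> E"
    using depth_walk[OF assms(1)] by auto
  then have reach: "(r, w) \<in> E\<^sup>*"
    by (auto simp: rtrancl_power)
  have "Suc (depth w) = depth u"
    using depth_le[OF w(1)] depth_step[OF reach w(2)] k by linarith
  moreover have "(u, w) \<in> E"
    using w symE by (auto dest: symD)
  ultimately have "\<exists>w. (r, w) \<in> E\<^sup>* \<and> (u, w) \<in> E \<and> Suc (depth w) = depth u"
    using reach by blast
  from someI_ex[OF this] show "(r, parent u) \<in> E\<^sup>*" "(u, parent u) \<in> E"
      "Suc (depth (parent u)) = depth u"
    unfolding parent_def by auto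
qed

lemma ancestor_reachable_depth:
  assumes "(r, u) \<in> E\<^sup>*" "i \<le> depth u"
  shows "(r, (parent ^^ i) u) \<in> E\<^sup>* \<and> depth ((parent ^^ i) u) = depth u - i"
  using assms(2)
proof (induction i)
  case 0
  with assms show ?case by simp
next
  case (Suc i)
  then have "(parent ^^ i) u \<noteq> r"
    by auto
  with Suc parent[of "(parent ^^ i) u"] show ?case
    by simp
qed

lemmas ancestor = ancestor_reachable_depth[THEN conjunct1] ancestor_reachable_depth[THEN conjunct2]

lemma ancestor_step:
  assumes "(r, u) \<in> E\<^sup>*" "i < depth u"
  shows "((parent ^^ i) u, (parent ^^ Suc i) u) \<in> E"
proof -
  have "(parent ^^ i) u \<noteq> r"
    using ancestor(2)[of u i] assms by auto
  then show ?thesis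
    using parent(2)[of "(parent ^^ i) u"] ancestor(1)[of u i] assms by simp
qed

lemma ancestor_root: "(r, u) \<in> E\<^sup>* \<Longrightarrow> (parent ^^ depth u) u = r"
  using ancestor[of u "depth u"] depth_eq_0 by simp

text \<open>Two different such neighbours would give a non-backtracking closed walk: climb from the root
  to \<open>v\<close>, step to \<open>u\<close>, then to \<open>v'\<close>, and descend to the root again.\<close>
lemma lower_neighbour_unique:
  assumes u: "(r, u) \<in> E\<^sup>*" and v: "(u, v) \<in> E" "depth v \<le> depth u" "depth v \<le> R"
    and v': "(u, v') \<in> E" "depth v' \<le> depth u" "depth v' \<le> R"
  shows "v = v'"
proof (rule ccontr)
  assume "v \<noteq> v'"
  define a where "a = depth v"
  define b where "b = depth v'"
  define x where "x i = (if i \<le> a then (parent ^^ (a - i)) v else if i = Suc a then u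
    else (parent ^^ (i - a - 2)) v')" for i
  \<comment> \<open>\<open>h i\<close> is the depth of \<open>x i\<close>. It rises by one up to
    \<open>v\<close>, is at least \<open>a\<close> and \<open>b\<close> at \<open>u\<close>, and
    falls by one after \<open>v'\<close>. Vertices two steps apart thus differ in depth, except at
    \<open>i = a\<close>, where \<open>v \<noteq> v'\<close> is used.\<close>
  define h where "h i = (if i \<le> a then i else if i = Suc a then depth u else b - (i - a - 2))" for i
  have rv: "(r, v) \<in> E\<^sup>*" "(r, v') \<in> E\<^sup>*"
    using u v v' by (auto intro: rtrancl_into_rtrancl)
  have h: "depth (x i) = h i" if "i \<le> a + 2 + b" for i
    using that ancestor(2)[OF rv(1)] ancestor(2)[OF rv(2)] by (auto simp: x_def h_def a_def b_def)
  have "\<not> acyclic_upto (2 * R + 2) E"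
  proof (rule nonbacktracking_closed_walk_contains_cycle[of _ "a + 2 + b" x])
    fix i
    assume i: "i < a + 2 + b"
    consider "i < a" | "i = a" | "i = Suc a" | "a + 2 \<le> i" by linarith
    then show "(x i, x (Suc i)) \<in> E"
    proof cases
      case 1
      then have "a - i = Suc (a - Suc i)" by simp
      with 1 ancestor_step[OF rv(1), of "a - Suc i"] symE show ?thesis
        by (auto simp: x_def a_def dest: symD)
    next
      case 2 with v symE show ?thesis by (auto simp: x_def dest: symD)
    next
      case 3 with v' show ?thesis by (auto simp: x_def)
    next
      case 4
      then have "Suc i - a - 2 = Suc (i - a - 2)" by simp
      with 4 i ancestor_step[OF rv(2), of "i - a - 2"] show ?thesis
        by (auto simp: x_def b_def)
    qed
  next
    fix i
    assume i: "i + 2 \<le> a + 2 + b"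
    show "x i \<noteq> x (i + 2)"
    proof (cases "i = a")
      case True
      then show ?thesis using \<open>v \<noteq> v'\<close> by (simp add: x_def)
    next
      case False
      have "a \<le> depth u" "b \<le> depth u"
        using v v' by (auto simp: a_def b_def)
      then have "h i \<noteq> h (i + 2)"
        using False i by (auto simp: h_def)
      then show ?thesis
        using h[of i] h[of "i + 2"] i by auto
    qed
  next
    show "x (a + 2 + b) = x 0"
      using ancestor_root[OF rv(1)] ancestor_root[OF rv(2)] by (simp add: x_def a_def b_def)
  qed (use v v' irreflE in \<open>auto simp: a_def b_def\<close>)
  with acyc show False by simp
qed

text \<open>The end of an edge that is not deeper than the other must be the parent of the other, by
  uniqueness of the lower neighbour. This also excludes edges between vertices of equal depth, so
  every edge inside the ball is a tree edge.\<close>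

lemma adjacent_parent:
  assumes "(r, u) \<in> E\<^sup>*" "(u, v) \<in> E" "depth u \<le> R" "depth v \<le> R"
  shows "u \<noteq> r \<and> v = parent u \<or> v \<noteq> r \<and> u = parent v"
proof -
  have *: "u \<noteq> r \<and> v = parent u"
    if "(r, u) \<in> E\<^sup>*" "(u, v) \<in> E" "depth u \<le> R" "depth v \<le> depth u" for u v
  proof -
    \<comment> \<open>If \<open>u = r\<close>, then \<open>v\<close> has depth 0 as well, and the
      edge would be a loop.\<close>
    have "u \<noteq> r"
      using that irreflE depth_eq_0[of v]
      by (metis depth_root irrefl_def le_zero_eq rtrancl.rtrancl_into_rtrancl)
    with parent[OF that(1)] that lower_neighbour_unique[OF that(1), of v "parent u"]
    show ?thesis by auto
  qed
  have "(r, v) \<in> E\<^sup>*" "(v, u) \<in> E"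
    using assms symE by (auto dest: symD intro: rtrancl_into_rtrancl)
  then show ?thesis
    using *[of u v] *[of v u] assms by linarith
qed

definition ball :: "'a set" where
  "ball = {u. (r, u) \<in> E\<^sup>* \<and> depth u \<le> R}"

text \<open>The descendants of \<open>c\<close> in the ball. The guard
  \<open>i \<le> depth u\<close> stops the chain of parents at \<open>r\<close>, where
  \<open>parent\<close> is unspecified.\<close>

definition branch :: "'a \<Rightarrow> 'a set" where
  "branch c = {u \<in> ball. \<exists>i \<le> depth u. (parent ^^ i) u = c}"

lemma branch_root: "branch r = ball"
  using ancestor_root by (auto simp: branch_def ball_def)

lemma branch_parent:
  assumes "u \<in> ball" "u \<noteq> r" "parent u \<in> branch c"
  shows "u \<in> branch c"
proof -
  obtain i where "i \<le> depth (parent u)" "(parent ^^ i) (parent u) = c"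
    using assms by (auto simp: branch_def)
  moreover have "Suc (depth (parent u)) = depth u"
    using assms parent by (auto simp: ball_def)
  ultimately show ?thesis
    using assms(1) by (auto simp: branch_def funpow_swap1 intro!: exI[of _ "Suc i"])
qed

lemma parent_in_branch:
  assumes "u \<in> branch c" "u \<noteq> c"
  shows "u \<noteq> r" "parent u \<in> branch c"
proof -
  obtain i where i: "i \<le> depth u" "(parent ^^ i) u = c" and u: "u \<in> ball"
    using assms by (auto simp: branch_def)
  then obtain j where j: "i = Suc j"
    using assms(2) by (cases i) auto
  with i show "u \<noteq> r" by auto
  with parent[of u] u have "parent u \<in> ball" "Suc (depth (parent u)) = depth u"
    by (auto simp: ball_def)
  with i j show "parent u \<in> branch c"
    by (auto simp: branch_def funpow_swap1 intro!: exI[of _ j])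
qed

text \<open>The chain of ancestors of a vertex below \<open>u\<close> passes through a child of
  \<open>u\<close> just before it reaches \<open>u\<close>.\<close>

lemma branch_subset:
  "branch u \<subseteq> insert u (\<Union>c \<in> {c \<in> ball. c \<noteq> r \<and> parent c = u}. branch c)"
proof
  fix v
  assume "v \<in> branch u"
  then obtain i where v: "v \<in> ball" and i: "i \<le> depth v" "(parent ^^ i) v = u"
    by (auto simp: branch_def)
  show "v \<in> insert u (\<Union>c \<in> {c \<in> ball. c \<noteq> r \<and> parent c = u}. branch c)"
  proof (cases i)
    case 0
    with i show ?thesis by simp
  next
    case (Suc j)
    let ?c = "(parent ^^ j) v"
    have "?c \<in> ball" "depth ?c \<noteq> 0"
      using v i Suc ancestor[of v j] by (auto simp: ball_def)
    then have "?c \<in> {c \<in> ball. c \<noteq> r \<and> parent c = u}"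
      using i Suc by auto
    moreover have "v \<in> branch ?c"
      using v i Suc by (auto simp: branch_def intro!: exI[of _ j])
    ultimately show ?thesis by blast
  qed
qed

text \<open>A step from a vertex other than \<open>c\<close> goes to its parent or to a child, and
  both still belong to the branch. So the walk has to visit \<open>c\<close>, and its remainder is
  the walk claimed. The depth premise keeps it inside the ball until then.\<close>

lemma leaves_branch_through_root:
  assumes "(u, v) \<in> E ^^ k" "u \<in> branch c" "depth u + k \<le> R" "v \<notin> branch c"
  shows "\<exists>j\<le>k. (c, v) \<in> E ^^ j"
  using assms
proof (induction k arbitrary: u)
  case 0
  then show ?case by simp
next
  case (Suc k)
  show ?case
  proof (cases "u = c")
    case True
    with Suc.prems(1) show ?thesis by blast
  next
    case False
    obtain w where w: "(u, w) \<in> E" "(w, v) \<in> E ^^ k"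
      using Suc.prems(1) by (meson relpow_Suc_D2)
    have u: "(r, u) \<in> E\<^sup>*" "u \<in> ball"
      using Suc.prems by (auto simp: branch_def ball_def)
    have dw: "depth w + k \<le> R" 
      using depth_step[OF u(1) w(1)] Suc.prems(3) by simp
    have "w \<in> ball"
      using u w dw by (auto simp: ball_def intro: rtrancl_into_rtrancl)
    moreover have "u \<noteq> r \<and> w = parent u \<or> w \<noteq> r \<and> u = parent w"
      using adjacent_parent[OF u(1) w(1)] Suc.prems(3) dw by simp
    ultimately have "w \<in> branch c"
      using parent_in_branch[OF Suc.prems(2) False] branch_parent[of w c] Suc.prems(2) by auto
    then show ?thesis
      using Suc.IH[OF w(2) _ dw Suc.prems(4)] le_SucI by blast
  qed
qed

end

section \<open>Counting under a degree bound, and a balanced separator\<close>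

lemma card_relpow_le:
  fixes E :: "('a \<times> 'a) set"
  assumes "\<And>u. finite (E `` {u})" "\<And>u. card (E `` {u}) \<le> d"
  shows "finite ((E ^^ k) `` {c}) \<and> card ((E ^^ k) `` {c}) \<le> d ^ k"
proof (induction k)
  case 0
  then show ?case by simp
next
  case (Suc k)
  have eq: "(E ^^ Suc k) `` {c} = (\<Union>u \<in> (E ^^ k) `` {c}. E `` {u})"
    by auto
  have "card ((E ^^ Suc k) `` {c}) \<le> (\<Sum>u \<in> (E ^^ k) `` {c}. card (E `` {u}))"
    unfolding eq using Suc by (intro card_UN_le) auto
  also have "\<dots> \<le> card ((E ^^ k) `` {c}) * d"
    using sum_bounded_above[of _ "\<lambda>u. card (E `` {u})" d] assms by simp
  also have "\<dots> \<le> d ^ Suc k"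
    using Suc by (simp add: mult.commute)
  finally show ?case
    using Suc assms unfolding eq by auto
qed

lemma card_vimage_le:
  assumes "finite V" "finite Z" "\<And>z. z \<in> Z \<Longrightarrow> card {x \<in> V. \<phi> x = z} \<le> \<kappa>"
  shows "card {x \<in> V. \<phi> x \<in> Z} \<le> \<kappa> * card Z"
proof -
  have "{x \<in> V. \<phi> x \<in> Z} = (\<Union>z\<in>Z. {x \<in> V. \<phi> x = z})"
    by auto
  also have "card \<dots> \<le> (\<Sum>z\<in>Z. card {x \<in> V. \<phi> x = z})"
    using assms by (intro card_UN_le)
  also have "\<dots> \<le> \<kappa> * card Z"
    using sum_bounded_above[of Z "\<lambda>z. card {x \<in> V. \<phi> x = z}" \<kappa>] assms by (simp add: mult.commute)
  finally show ?thesis .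
qed

context tree_like_ball
begin

text \<open>The set \<open>A\<close> is the preimage of a heaviest branch hanging off a deepest vertex whose branch
  carries more than half of the vertices.\<close>
lemma balanced_separator:
  fixes V :: "'c set" and F :: "('c \<times> 'c) set" and \<phi> :: "'c \<Rightarrow> 'a"
  assumes deg: "\<And>u. finite (E `` {u})" "\<And>u. card (E `` {u}) \<le> d"
    and V: "finite V" "2 * \<kappa> < card V"
    and \<phi>: "\<And>x. x \<in> V \<Longrightarrow> (r, \<phi> x) \<in> E\<^sup>*" "\<And>x. x \<in> V \<Longrightarrow> depth (\<phi> x) + K \<le> R"
    and lip: "\<And>x y. (x, y) \<in> F \<Longrightarrow> \<exists>j\<le>K. (\<phi> x, \<phi> y) \<in> E ^^ j"
    and fib: "\<And>z. card {x \<in> V. \<phi> x = z} \<le> \<kappa>"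
  obtains A where "A \<subseteq> V" "A \<noteq> {}" "2 * card A \<le> card V" "card V \<le> 2 * \<kappa> + 2 * d * card A"
    "card {y \<in> V - A. \<exists>x\<in>A. (x, y) \<in> F} \<le> \<kappa> * (\<Sum>k\<le>K. d ^ k)"
proof -
  define S where "S u = {x \<in> V. \<phi> x \<in> branch u}" for u
  have finS: "finite (S u)" for u
    using V by (simp add: S_def)
  have inball: "\<phi> x \<in> ball" if "x \<in> V" for x
    using \<phi>[OF that] by (simp add: ball_def)
  define heavy where "heavy u \<longleftrightarrow> u \<in> ball \<and> card V < 2 * card (S u)" for u
  have "S r = V"
    using inball by (auto simp: S_def branch_root)
  then have "heavy r"
    using V by (auto simp: heavy_def ball_def)
  moreover have "\<forall>u. heavy u \<longrightarrow> depth u < Suc R"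
    by (auto simp: heavy_def ball_def)
  ultimately obtain u where u: "heavy u" and deepest: "\<And>v. heavy v \<Longrightarrow> depth v \<le> depth u"
    using ex_has_greatest_nat[of heavy r depth "Suc R"] by blast
  define C where "C = {c \<in> ball. c \<noteq> r \<and> parent c = u}"
  have "C \<subseteq> E `` {u}"
    using parent symE by (fastforce simp: C_def ball_def dest: symD)
  then have C: "finite C" "card C \<le> d"
    using deg by (meson finite_subset, meson card_mono le_trans)
  \<comment> \<open>A child of \<open>u\<close> is one level deeper than \<open>u\<close>, so it is
    not heavy by the choice of \<open>u\<close>.\<close>
  have light: "2 * card (S c) \<le> card V" if "c \<in> C" for c
  proof -
    have "Suc (depth u) = depth c"
      using that parent by (auto simp: C_def ball_def)
    then show ?thesis
      using deepest[of c] that by (fastforce simp: heavy_def C_def)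
  qed
  have "S u \<subseteq> {x \<in> V. \<phi> x = u} \<union> (\<Union>c\<in>C. S c)"
    using branch_subset[of u] by (auto simp: S_def C_def)
  then have "card (S u) \<le> card ({x \<in> V. \<phi> x = u} \<union> (\<Union>c\<in>C. S c))"
    using V C finS by (intro card_mono) auto
  also have "\<dots> \<le> card {x \<in> V. \<phi> x = u} + card (\<Union>c\<in>C. S c)"
    by (rule card_Un_le)
  also have "\<dots> \<le> \<kappa> + (\<Sum>c\<in>C. card (S c))"
    using fib[of u] C by (intro add_mono card_UN_le)
  finally have sum: "card (S u) \<le> \<kappa> + (\<Sum>c\<in>C. card (S c))" .
  \<comment> \<open>Otherwise \<open>S u\<close> would have at most \<open>\<kappa>\<close>
    elements, although it contains more than half of more than \<open>2 * \<kappa>\<close>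
    vertices.\<close>
  have "C \<noteq> {}"
    using sum u V by (auto simp: heavy_def)
  then have "Max ((\<lambda>c. card (S c)) ` C) \<in> (\<lambda>c. card (S c)) ` C"
    using C by (intro Max_in) auto
  then obtain c where c: "c \<in> C" and "card (S c) = Max ((\<lambda>c. card (S c)) ` C)"
    by auto
  then have max: "card (S c') \<le> card (S c)" if "c' \<in> C" for c'
    using that C by simp
  \<comment> \<open>Averaging: at most \<open>d\<close> children share what \<open>S u\<close>
    contains beyond the fibre of \<open>u\<close>.\<close>
  have "(\<Sum>c\<in>C. card (S c)) \<le> card C * card (S c)"
    using sum_bounded_above[of C "\<lambda>c. card (S c)"] max by simp
  also have "\<dots> \<le> d * card (S c)"
    using C by simp
  finally have "card V < 2 * \<kappa> + 2 * d * card (S c)"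
    using sum u by (simp add: heavy_def)
  show thesis
  proof (rule that)
    show "S c \<subseteq> V"
      by (auto simp: S_def)
    show "S c \<noteq> {}"
      using \<open>card V < 2 * \<kappa> + 2 * d * card (S c)\<close> V by auto
    show "2 * card (S c) \<le> card V"
      using c by (rule light)
    show "card V \<le> 2 * \<kappa> + 2 * d * card (S c)"
      using \<open>card V < 2 * \<kappa> + 2 * d * card (S c)\<close> by simp
    \<comment> \<open>\<open>Z\<close> is the set of vertices within distance \<open>K\<close> of
      \<open>c\<close>. An edge leaving \<open>S c\<close> is mapped to a walk of length at most
      \<open>K\<close> that leaves \<open>branch c\<close>, hence passes through \<open>c\<close>
      and ends in \<open>Z\<close>.\<close>
    define Z where "Z = (\<Union>k\<in>{..K}. (E ^^ k) `` {c})"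
    have "finite Z"
      unfolding Z_def using card_relpow_le[OF deg] by blast
    have "card Z \<le> (\<Sum>k\<le>K. card ((E ^^ k) `` {c}))"
      unfolding Z_def by (intro card_UN_le) simp
    also have "\<dots> \<le> (\<Sum>k\<le>K. d ^ k)"
      using card_relpow_le[OF deg] by (intro sum_mono) simp
    finally have cardZ: "card Z \<le> (\<Sum>k\<le>K. d ^ k)" .
    have "{y \<in> V - S c. \<exists>x\<in>S c. (x, y) \<in> F} \<subseteq> {y \<in> V. \<phi> y \<in> Z}"
    proof clarify
      fix y x
      assume y: "y \<in> V" "y \<notin> S c" and x: "x \<in> S c" "(x, y) \<in> F"
      obtain j where j: "j \<le> K" "(\<phi> x, \<phi> y) \<in> E ^^ j"
        using lip[OF x(2)] by blast
      have "\<phi> y \<notin> branch c" "\<phi> x \<in> branch c" "x \<in> V"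
        using x y by (auto simp: S_def)
      moreover have "depth (\<phi> x) + j \<le> R"
        using \<phi>(2)[OF \<open>x \<in> V\<close>] j by simp
      ultimately obtain i where "i \<le> j" "(c, \<phi> y) \<in> E ^^ i"
        using leaves_branch_through_root[OF j(2)] by blast
      then show "\<phi> y \<in> Z"
        using j by (auto simp: Z_def)
    qed
    then have "card {y \<in> V - S c. \<exists>x\<in>S c. (x, y) \<in> F} \<le> card {y \<in> V. \<phi> y \<in> Z}"
      using V by (intro card_mono) auto
    also have "\<dots> \<le> \<kappa> * card Z"
      using V \<open>finite Z\<close> fib by (intro card_vimage_le)
    also have "\<dots> \<le> \<kappa> * (\<Sum>k\<le>K. d ^ k)"
      using cardZ by simp
    finally show "card {y \<in> V - S c. \<exists>x\<in>S c. (x, y) \<in> F} \<le> \<kappa> * (\<Sum>k\<le>K. d ^ k)" .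
  qed
qed

end

section \<open>Girth, walks and distances\<close>

text \<open>Choosing one arc for each step turns a short cycle of the edge relation into an arc list
  satisfying \<open>cycle\<close>, which \<open>girth\<close> forbids.\<close>

lemma acyclic_upto_if_less_girth:
  assumes "wf_digraph G" "enat L < girth G"
  shows "acyclic_upto L (arcs_ends G)"
  unfolding acyclic_upto_def
proof
  interpret wf_digraph G by fact
  assume "\<exists>n x. 3 \<le> n \<and> n \<le> L \<and> x n = x 0 \<and> inj_on x {..<n} \<and> (\<forall>i<n. (x i, x (Suc i)) \<in> arcs_ends G)"
  then obtain n x where n: "3 \<le> n" "n \<le> L" and x: "x n = x 0" "inj_on x {..<n}"
    and edge: "\<forall>i<n. (x i, x (Suc i)) \<in> arcs_ends G"
    by blast
  have "\<forall>i<n. \<exists>a. a \<in> arcs G \<and> tail G a = x i \<and> head G a = x (Suc i)"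
    using edge by blast
  then obtain e where e: "\<And>i. i < n \<Longrightarrow> e i \<in> arcs G \<and> tail G (e i) = x i \<and> head G (e i) = x (Suc i)"
    by metis
  define p where "p = map e [0..<n]"
  \<comment> \<open>The induction runs over suffixes of growing length, since \<open>cas\<close>
    recurses on the first arc.\<close>
  have cas: "cas (x (n - k)) (map e [n - k..<n]) (x n)" if "k \<le> n" for k
    using that
  proof (induction k)
    case 0
    then show ?case by simp
  next
    case (Suc k)
    then have "[n - Suc k..<n] = (n - Suc k) # [n - k..<n]" "Suc (n - Suc k) = n - k"
      by (simp_all add: upt_rec Suc_diff_Suc)
    with Suc e[of "n - Suc k"] show ?case by simp
  qed
  have "cas (x 0) p (x 0)"
    using cas[of n] x by (simp add: p_def)
  moreover have "x 0 \<in> verts G"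
    using e[of 0] n tail_in_verts[of "e 0"] by simp
  ultimately have walk: "awalk (x 0) p (x 0)"
    using e by (auto simp: awalk_def p_def)
  \<comment> \<open>The heads of the arcs are \<open>x 1\<close> to \<open>x n\<close>. Replacing
    the last by the equal vertex \<open>x 0\<close> brings all indices below \<open>n\<close>, where
    \<open>x\<close> is injective.\<close>
  have "inj_on (\<lambda>i. x (Suc i)) {0..<n}"
  proof (rule inj_onI)
    fix i j
    assume ij: "i \<in> {0..<n}" "j \<in> {0..<n}" "x (Suc i) = x (Suc j)"
    have "x (Suc k) = x (if Suc k = n then 0 else Suc k)" for k
      using x by simp
    with ij have "x (if Suc i = n then 0 else Suc i) = x (if Suc j = n then 0 else Suc j)"
      by metis
    then have "(if Suc i = n then 0 else Suc i) = (if Suc j = n then 0 else Suc j)"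
      by (rule inj_onD[OF x(2)]) (use ij in auto)
    then show "i = j"
      by (auto split: if_splits)
  qed
  moreover have "map (head G) p = map (\<lambda>i. x (Suc i)) [0..<n]"
    using e by (simp add: p_def)
  ultimately have "distinct (map (head G) p)"
    by (simp add: distinct_map)
  then have "distinct (tl (awalk_verts (x 0) p))"
    using awalk_verts_conv'[OF \<open>cas (x 0) p (x 0)\<close>] by simp
  with walk n have "cycle p" "length p = n"
    by (auto simp: cycle_def p_def)
  then have "girth G \<le> enat n"
    unfolding girth_def using n by (intro INF_lower2[of p]) auto
  with assms(2) n(2) show False
    by (metis enat_ord_simps(1) leD order_trans)
qed

lemma awalk_relpow:
  assumes "wf_digraph G" "pre_digraph.awalk G u p v"
  shows "(u, v) \<in> arcs_ends G ^^ length p"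
  using assms(2)
proof (induction p arbitrary: u)
  case Nil
  then show ?case by (simp add: wf_digraph.awalk_Nil_iff[OF assms(1)])
next
  case (Cons e p)
  then have "(u, head G e) \<in> arcs_ends G" "(head G e, v) \<in> arcs_ends G ^^ length p"
    by (auto simp: wf_digraph.awalk_Cons_iff[OF assms(1)] arcs_ends_conv)
  then have "(u, v) \<in> arcs_ends G ^^ Suc (length p)"
    by (rule relpow_Suc_I2)
  then show ?case by simp
qed

lemma relpow_if_graph_dist_le:
  assumes G: "wf_digraph G" and "graph_dist G u v \<le> ereal (real k)"
  shows "\<exists>j\<le>k. (u, v) \<in> arcs_ends G ^^ j"
proof -
  \<comment> \<open>A strict bound on an infimum yields an actual walk below it; lengths below
    \<open>Suc k\<close> are at most \<open>k\<close>.\<close>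
  have "graph_dist G u v < ereal (real (Suc k))"
    using assms(2) by (rule order_le_less_trans) simp
  then obtain p where "pre_digraph.awalk G u p v" "length p < Suc k"
    unfolding graph_dist_eq_length[OF G] by (auto simp: INF_less_iff)
  with awalk_relpow[OF G] show ?thesis
    by (metis less_Suc_eq_le)
qed

lemma graph_dist_nonneg: "wf_digraph G \<Longrightarrow> 0 \<le> graph_dist G u v"
  by (simp add: graph_dist_eq_length le_INF_iff)

lemma graph_dist_adjacent_le_1:
  assumes G: "wf_digraph G" and "(u, v) \<in> arcs_ends G"
  shows "graph_dist G u v \<le> 1"
proof -
  obtain e where "e \<in> arcs G" "tail G e = u" "head G e = v"
    using assms(2) by blast
  then have "pre_digraph.awalk G u [e] v"
    using G by (auto simp: pre_digraph.awalk_def pre_digraph.cas.simps wf_digraph_def)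
  then show ?thesis
    unfolding graph_dist_eq_length[OF G] by (intro INF_lower2[of "[e]"]) auto
qed

text \<open>Adjacent vertices have distance at most 1, so the Lipschitz constant bounds the distance
  of their images. It is made natural by rounding up its absolute value, as its sign is not
  prescribed.\<close>

lemma regular_map_edge_stretch:
  assumes X: "wf_digraph X" and Y: "wf_digraph Y" and "regular_map X Y \<phi>"
  obtains K :: nat where "\<And>x y. (x, y) \<in> arcs_ends X \<Longrightarrow> \<exists>j\<le>K. (\<phi> x, \<phi> y) \<in> arcs_ends Y ^^ j"
proof -
  obtain L :: real where L: "\<And>x y. \<lbrakk>x \<in> verts X; y \<in> verts X; x \<rightarrow>\<^sup>*\<^bsub>X\<^esub> y\<rbrakk> \<Longrightarrow>
      graph_dist Y (\<phi> x) (\<phi> y) \<le> ereal L * graph_dist X x y"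
    using assms(3) unfolding regular_map_def by blast
  show thesis
  proof (rule that)
    fix x y
    assume xy: "(x, y) \<in> arcs_ends X"
    have "x \<rightarrow>\<^sup>*\<^bsub>X\<^esub> y" "x \<in> verts X" "y \<in> verts X"
      using wf_digraph.reachable_adjI[OF X xy] wf_digraph.adj_in_verts[OF X xy] by auto
    then have "graph_dist Y (\<phi> x) (\<phi> y) \<le> ereal L * graph_dist X x y"
      using L by blast
    also have "\<dots> \<le> ereal \<bar>L\<bar> * graph_dist X x y"
      using graph_dist_nonneg[OF X] by (intro ereal_mult_right_mono) auto
    also have "\<dots> \<le> ereal \<bar>L\<bar> * 1"
      using graph_dist_adjacent_le_1[OF X xy] by (intro ereal_mult_left_mono) auto
    also have "\<dots> \<le> ereal (real (nat \<lceil>\<bar>L\<bar>\<rceil>))"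
      by (simp add: real_nat_ceiling_ge)
    finally show "\<exists>j\<le>nat \<lceil>\<bar>L\<bar>\<rceil>. (\<phi> x, \<phi> y) \<in> arcs_ends Y ^^ j"
      by (rule relpow_if_graph_dist_le[OF Y])
  qed
qed

section \<open>Disjoint unions, the Cheeger bound and connectedness\<close>

lemma arcs_ends_disjoint_union:
  "((m, a), (n, b)) \<in> arcs_ends (disjoint_union I \<Gamma>) \<longleftrightarrow>
     m \<in> I \<and> n = m \<and> (a, b) \<in> arcs_ends (\<Gamma> m)"
  by (fastforce simp: arcs_ends_conv disjoint_union_def image_iff)

lemma relpow_disjoint_union:
  assumes "(p, q) \<in> arcs_ends (disjoint_union I \<Gamma>) ^^ k"
  shows "fst q = fst p \<and> (snd p, snd q) \<in> arcs_ends (\<Gamma> (fst p)) ^^ k"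
  using assms
proof (induction k arbitrary: q)
  case 0
  then show ?case by simp
next
  case (Suc k)
  then obtain s where s: "(p, s) \<in> arcs_ends (disjoint_union I \<Gamma>) ^^ k"
      "(s, q) \<in> arcs_ends (disjoint_union I \<Gamma>)"
    by auto
  then have "fst q = fst s \<and> (snd s, snd q) \<in> arcs_ends (\<Gamma> (fst s))"
    by (metis arcs_ends_disjoint_union prod.collapse)
  with Suc.IH[OF s(1)] show ?case by auto
qed

text \<open>\<open>Min\<close> is a lower bound only for a finite set; here the ratios are indexed
  by subsets of the finite vertex set.\<close>

lemma (in graph) cheeger_boundary:
  assumes "\<epsilon> \<le> cheeger_constant G" "A \<subseteq> verts G" "A \<noteq> {}" "2 * card A \<le> card (verts G)"
  shows "\<epsilon> * card A \<le> card (vertex_boundary G A)"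
proof -
  let ?S = "{real (card (vertex_boundary G A)) / real (card A) | A.
      A \<subseteq> verts G \<and> A \<noteq> {} \<and> real (card A) \<le> real (card (verts G)) / 2}"
  have "?S \<subseteq> (\<lambda>A. real (card (vertex_boundary G A)) / real (card A)) ` Pow (verts G)"
    by auto
  then have "finite ?S"
    by (rule finite_subset) simp
  moreover have "real (card (vertex_boundary G A)) / real (card A) \<in> ?S"
    by (intro CollectI exI[of _ A]) (use assms in auto)
  ultimately have "cheeger_constant G \<le> real (card (vertex_boundary G A)) / real (card A)"
    unfolding cheeger_constant_def by (rule Min_le)
  moreover have "0 < card A"
    using assms finite_subset[OF assms(2)] by (simp add: card_gt_0_iff)
  ultimately have "cheeger_constant G * card A \<le> card (vertex_boundary G A)"
    by (simp add: field_simps)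
  then show ?thesis
    using mult_right_mono[OF assms(1), of "real (card A)"] by simp
qed

text \<open>Otherwise the component of \<open>x\<close> and its complement are both nonempty with
  empty boundary. By expansion each would contain more than half of the vertices.\<close>

lemma (in graph) connected_if_cheeger_pos:
  assumes "0 < cheeger_constant G" "x \<in> verts G" "y \<in> verts G"
  shows "(x, y) \<in> (arcs_ends G)\<^sup>*"
proof (rule ccontr)
  assume not: "(x, y) \<notin> (arcs_ends G)\<^sup>*"
  define A where "A = {z \<in> verts G. (x, z) \<in> (arcs_ends G)\<^sup>*}"
  have A: "A \<subseteq> verts G" "x \<in> A" "y \<in> verts G - A"
    using assms not by (auto simp: A_def)
  have step: "u \<in> A \<longleftrightarrow> v \<in> A" if "(u, v) \<in> arcs_ends G" for u v
    using that adj_in_verts[OF that] arcs_ends_symmetric[OF sym_arcs that]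
    by (auto simp: A_def intro: rtrancl_into_rtrancl)
  have large: "card (verts G) < 2 * card B"
    if B: "B \<subseteq> verts G" "B \<noteq> {}" "\<And>u v. (u, v) \<in> arcs_ends G \<Longrightarrow> u \<in> B \<longleftrightarrow> v \<in> B" for B
  proof (rule ccontr)
    assume "\<not> card (verts G) < 2 * card B"
    moreover have "vertex_boundary G B = {}"
      using B(3) by (auto simp: vertex_boundary_def)
    ultimately have "cheeger_constant G * card B \<le> 0"
      using cheeger_boundary[OF order_refl B(1,2)] by simp
    moreover have "0 < card B"
      using B finite_subset[OF B(1)] by (simp add: card_gt_0_iff)
    ultimately show False
      using assms(1) by (simp add: mult_le_0_iff)
  qed
  have "card (verts G) < 2 * card A"
    using A step by (intro large) auto
  moreover have "card (verts G) < 2 * card (verts G - A)"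
    using A step adj_in_verts by (intro large) blast+
  moreover have "card (verts G - A) = card (verts G) - card A" "card A \<le> card (verts G)"
    using A finite_subset[OF A(1)] by (simp_all add: card_Diff_subset card_mono)
  ultimately show False by linarith
qed

section \<open>Finitely many graphs up to isomorphism of bounded order\<close>

text \<open>Without parallel arcs an arc is determined by its ends, so a bijection of vertices that
  preserves adjacency induces the bijection \<open>g\<close> of arcs.\<close>

lemma digraph_isoI:
  assumes "graph G" "graph H" and f: "bij_betw f (verts G) (verts H)"
    and edges: "arcs_ends H = map_prod f f ` arcs_ends G"
  shows "digraph_iso G H"
proof -
  interpret G: graph G by fact
  interpret H: graph H by fact
  define g where "g a = the_inv_into (arcs H) (arc_to_ends H) (map_prod f f (arc_to_ends G a))" for a
  have bijH: "bij_betw (arc_to_ends H) (arcs H) (arcs_ends H)"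
    using H.inj_on_arc_to_ends by (simp add: bij_betw_def arcs_ends_def)
  have "inj_on (map_prod f f) (arcs_ends G)"
    using f G.adj_in_verts by (auto simp: bij_betw_def inj_on_def)
  then have "bij_betw (map_prod f f) (arcs_ends G) (arcs_ends H)"
    using edges by (simp add: bij_betw_def)
  moreover have "bij_betw (arc_to_ends G) (arcs G) (arcs_ends G)"
    using G.inj_on_arc_to_ends by (simp add: bij_betw_def arcs_ends_def)
  ultimately have "bij_betw (the_inv_into (arcs H) (arc_to_ends H) \<circ> (map_prod f f \<circ> arc_to_ends G))
      (arcs G) (arcs H)"
    using bij_betw_the_inv_into[OF bijH] by (blast intro: bij_betw_trans)
  moreover have "the_inv_into (arcs H) (arc_to_ends H) \<circ> (map_prod f f \<circ> arc_to_ends G) = g"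
    by (simp add: fun_eq_iff g_def)
  ultimately have g: "bij_betw g (arcs G) (arcs H)"
    by simp
  have ends: "arc_to_ends H (g a) = map_prod f f (arc_to_ends G a)" if "a \<in> arcs G" for a
    unfolding g_def using that bijH edges
    by (intro f_the_inv_into_f_bij_betw) (auto simp: arcs_ends_def)
  \<comment> \<open>Taking \<open>head H\<close> and \<open>tail H\<close> themselves makes
    \<open>app_iso hom G\<close> equal to \<open>H\<close> as a record.\<close>
  define hom where "hom = \<lparr>iso_verts = f, iso_arcs = g, iso_head = head H, iso_tail = tail H\<rparr>"
  have "G.digraph_isomorphism hom"
    using f g ends G.wf_digraph
    by (auto simp: G.digraph_isomorphism_def hom_def bij_betw_def arc_to_ends_def)
  moreover have "H = app_iso hom G"
    using f g by (simp add: app_iso_def hom_def bij_betw_def)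
  ultimately show ?thesis
    unfolding digraph_iso_def by blast
qed

text \<open>Numbering the vertices encodes a graph by its order and a set of pairs of numbers. Only
  finitely many codes have order at most \<open>C\<close>, and equal codes give isomorphic
  graphs.\<close>

lemma finite_small_nonisomorphic_graphs:
  fixes \<Gamma> :: "nat \<Rightarrow> ('a, 'b) pre_digraph"
  assumes graph: "\<And>n. graph (\<Gamma> n)"
    and noniso: "\<And>m n. m \<noteq> n \<Longrightarrow> \<not> digraph_iso (\<Gamma> m) (\<Gamma> n)"
  shows "finite {n. card (verts (\<Gamma> n)) \<le> C}"
proof -
  let ?I = "{n. card (verts (\<Gamma> n)) \<le> C}"
  have fin: "finite (verts (\<Gamma> n))" for n
    using graph[of n] by (simp add: graph_def digraph_def fin_digraph.finite_verts)
  then have "\<exists>h. bij_betw h (verts (\<Gamma> n)) {0..<card (verts (\<Gamma> n))}" for n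
    by (rule ex_bij_betw_finite_nat)
  then obtain h where h: "\<And>n. bij_betw (h n) (verts (\<Gamma> n)) {0..<card (verts (\<Gamma> n))}"
    by metis
  \<comment> \<open>The order is recorded because the edges do not show isolated vertices.\<close>
  define code where "code n = (card (verts (\<Gamma> n)), map_prod (h n) (h n) ` arcs_ends (\<Gamma> n))" for n
  have verts: "arcs_ends (\<Gamma> n) \<subseteq> verts (\<Gamma> n) \<times> verts (\<Gamma> n)" for n
    using graph[of n] wf_digraph.adj_in_verts[of "\<Gamma> n"]
    by (auto simp: graph_def digraph_def fin_digraph_def)
  have "code ` ?I \<subseteq> {..C} \<times> Pow ({..<C} \<times> {..<C})"
  proof clarify
    fix n s E
    assume n: "card (verts (\<Gamma> n)) \<le> C" "(s, E) = code n"
    have "E \<subseteq> map_prod (h n) (h n) ` (verts (\<Gamma> n) \<times> verts (\<Gamma> n))"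
      using n verts[of n] by (auto simp: code_def)
    also have "\<dots> \<subseteq> {..<C} \<times> {..<C}"
      using bij_betwE[OF h[of n]] n by fastforce
    finally show "s \<in> {..C} \<and> E \<in> Pow ({..<C} \<times> {..<C})"
      using n by (simp add: code_def)
  qed
  then have "finite (code ` ?I)"
    by (rule finite_subset) simp
  moreover have "inj code"
  proof (rule injI, rule ccontr)
    fix m n
    assume eq: "code m = code n" and "m \<noteq> n"
    let ?f = "the_inv_into (verts (\<Gamma> n)) (h n) \<circ> h m"
    have inv: "the_inv_into (verts (\<Gamma> n)) (h n) (h n u) = u" if "u \<in> verts (\<Gamma> n)" for u
      using h[of n] that by (auto simp: bij_betw_def the_inv_into_f_f)
    have "bij_betw ?f (verts (\<Gamma> m)) (verts (\<Gamma> n))"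
      using h[of m] bij_betw_the_inv_into[OF h[of n]] eq
      by (auto simp: code_def intro: bij_betw_trans)
    moreover have "arcs_ends (\<Gamma> n) = map_prod ?f ?f ` arcs_ends (\<Gamma> m)"
    proof -
      let ?g = "the_inv_into (verts (\<Gamma> n)) (h n)"
      have "map_prod ?f ?f ` arcs_ends (\<Gamma> m) = map_prod ?g ?g ` map_prod (h m) (h m) ` arcs_ends (\<Gamma> m)"
        by (simp only: map_prod_compose image_comp)
      also have "map_prod (h m) (h m) ` arcs_ends (\<Gamma> m) = map_prod (h n) (h n) ` arcs_ends (\<Gamma> n)"
        using eq by (simp add: code_def)
      also have "map_prod ?g ?g ` map_prod (h n) (h n) ` arcs_ends (\<Gamma> n) = id ` arcs_ends (\<Gamma> n)"
        unfolding image_comp using verts[of n] inv by (intro image_cong) auto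
      finally show ?thesis
        unfolding image_id id_apply by (rule sym)
    qed
    ultimately have "digraph_iso (\<Gamma> m) (\<Gamma> n)"
      by (rule digraph_isoI[OF graph graph])
    with noniso[OF \<open>m \<noteq> n\<close>] show False ..
  qed
  ultimately show ?thesis
    by (metis finite_imageD inj_on_subset subset_UNIV)
qed

section \<open>Regular maps between components\<close>

text \<open>Each component of the domain is connected and edges are mapped to walks, which stay in
  one component of the target. What matters is that \<open>K\<close> and \<open>\<kappa>\<close> are
  the same for all components.\<close>

lemma regular_map_on_components:
  fixes \<Gamma> :: "nat \<Rightarrow> ('a, 'b) pre_digraph"
  assumes graph: "\<And>n. graph (\<Gamma> n)" and cheeger: "\<And>n. 0 < cheeger_constant (\<Gamma> n)"
    and verts: "\<And>n. verts (\<Gamma> n) \<noteq> {}"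
    and reg: "regular_map (disjoint_union M \<Gamma>) (disjoint_union N \<Gamma>) \<phi>"
  obtains K \<kappa> :: nat where "\<forall>n\<in>M. \<exists>m\<in>N. \<exists>\<psi>. \<psi> \<in> verts (\<Gamma> n) \<rightarrow> verts (\<Gamma> m) \<and>
      (\<forall>x y. (x, y) \<in> arcs_ends (\<Gamma> n) \<longrightarrow> (\<exists>j\<le>K. (\<psi> x, \<psi> y) \<in> arcs_ends (\<Gamma> m) ^^ j)) \<and>
      (\<forall>z. card {x \<in> verts (\<Gamma> n). \<psi> x = z} \<le> \<kappa>)"
proof -
  let ?X = "disjoint_union M \<Gamma>" and ?Y = "disjoint_union N \<Gamma>"
  have wf: "wf_digraph (\<Gamma> n)" for n
    using graph[of n] by (simp add: graph_def digraph_def fin_digraph_def)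
  have wfXY: "wf_digraph ?X" "wf_digraph ?Y"
    using wf by (auto intro: wf_digraph_disjoint_union)
  obtain K where K: "\<And>x y. (x, y) \<in> arcs_ends ?X \<Longrightarrow> \<exists>j\<le>K. (\<phi> x, \<phi> y) \<in> arcs_ends ?Y ^^ j"
    using regular_map_edge_stretch[OF wfXY reg] by blast
  obtain \<kappa> where \<kappa>: "\<And>z. z \<in> verts ?Y \<Longrightarrow>
      finite {x \<in> verts ?X. \<phi> x = z} \<and> card {x \<in> verts ?X. \<phi> x = z} \<le> \<kappa>"
    using reg unfolding regular_map_def by blast
  show thesis
  proof (rule that, rule ballI)
    fix n
    assume n: "n \<in> M"
    have range: "\<phi> (n, x) \<in> verts ?Y" if "x \<in> verts (\<Gamma> n)" for x
      using reg n that by (auto simp: regular_map_def disjoint_union_def)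
    obtain x0 where x0: "x0 \<in> verts (\<Gamma> n)"
      using verts by blast
    define m where "m = fst (\<phi> (n, x0))"
    define \<psi> where "\<psi> x = snd (\<phi> (n, x))" for x
    have stretch: "\<exists>j\<le>K. fst (\<phi> (n, y)) = fst (\<phi> (n, x)) \<and>
        (\<psi> x, \<psi> y) \<in> arcs_ends (\<Gamma> (fst (\<phi> (n, x)))) ^^ j"
      if "(x, y) \<in> arcs_ends (\<Gamma> n)" for x y
    proof -
      have "((n, x), (n, y)) \<in> arcs_ends ?X"
        using that n by (simp add: arcs_ends_disjoint_union)
      then show ?thesis
        using K relpow_disjoint_union unfolding \<psi>_def by blast
    qed
    have comp: "fst (\<phi> (n, x)) = m" if "x \<in> verts (\<Gamma> n)" for x
    proof -
      have "(x0, x) \<in> (arcs_ends (\<Gamma> n))\<^sup>*"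
        using graph.connected_if_cheeger_pos[OF graph cheeger x0 that] .
      then show ?thesis
        by induction (auto simp: m_def dest!: stretch)
    qed
    have \<phi>: "\<phi> (n, x) = (m, \<psi> x)" if "x \<in> verts (\<Gamma> n)" for x
      using comp[OF that] by (metis \<psi>_def prod.collapse)
    have "m \<in> N" and \<psi>: "\<psi> \<in> verts (\<Gamma> n) \<rightarrow> verts (\<Gamma> m)"
      using range \<phi> x0 by (fastforce simp: disjoint_union_def)+
    moreover have "\<exists>j\<le>K. (\<psi> x, \<psi> y) \<in> arcs_ends (\<Gamma> m) ^^ j"
      if xy: "(x, y) \<in> arcs_ends (\<Gamma> n)" for x y
      using stretch[OF xy] comp[OF wf_digraph.adj_in_verts(1)[OF wf xy]] by auto
    moreover have "card {x \<in> verts (\<Gamma> n). \<psi> x = z} \<le> \<kappa>" for z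
    proof (cases "z \<in> verts (\<Gamma> m)")
      case True
      then have z: "(m, z) \<in> verts ?Y"
        using \<open>m \<in> N\<close> by (simp add: disjoint_union_def)
      have "card {x \<in> verts (\<Gamma> n). \<psi> x = z} \<le> card {x \<in> verts ?X. \<phi> x = (m, z)}"
        using \<kappa>[OF z] \<phi> n by (intro card_inj_on_le[of "Pair n"])
          (auto simp: disjoint_union_def inj_on_def)
      with \<kappa>[OF z] show ?thesis by linarith
    next
      case False
      then have "{x \<in> verts (\<Gamma> n). \<psi> x = z} = {}"
        using \<psi> by auto
      then show ?thesis by (metis card.empty le0)
    qed
    ultimately show "\<exists>m\<in>N. \<exists>\<psi>. \<psi> \<in> verts (\<Gamma> n) \<rightarrow> verts (\<Gamma> m) \<and>
      (\<forall>x y. (x, y) \<in> arcs_ends (\<Gamma> n) \<longrightarrow> (\<exists>j\<le>K. (\<psi> x, \<psi> y) \<in> arcs_ends (\<Gamma> m) ^^ j)) \<and>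
      (\<forall>z. card {x \<in> verts (\<Gamma> n). \<psi> x = z} \<le> \<kappa>)"
      by blast
  qed
qed

lemma relpow_stretch:
  assumes "\<And>x y. (x, y) \<in> F \<Longrightarrow> \<exists>j\<le>K. (\<psi> x, \<psi> y) \<in> E ^^ j" and "(x, y) \<in> F ^^ n"
  shows "\<exists>j\<le>K * n. (\<psi> x, \<psi> y) \<in> E ^^ j"
  using assms(2)
proof (induction n arbitrary: y)
  case 0
  then show ?case by simp
next
  case (Suc n)
  then obtain z where z: "(x, z) \<in> F ^^ n" "(z, y) \<in> F"
    by auto
  obtain i j where "i \<le> K * n" "(\<psi> x, \<psi> z) \<in> E ^^ i" "j \<le> K" "(\<psi> z, \<psi> y) \<in> E ^^ j"
    using Suc.IH[OF z(1)] assms(1)[OF z(2)] by blast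
  then show ?case
    by (intro exI[of _ "i + j"]) (auto intro: relpow_trans)
qed

text \<open>The set \<open>A\<close> from \<open>balanced_separator\<close> has boundary bounded in
  terms of \<open>\<kappa>\<close>, \<open>d\<close> and \<open>K\<close>, so expansion bounds
  \<open>card A\<close>, and \<open>A\<close> is a fixed proportion of \<open>G\<close> up to
  \<open>2 * \<kappa>\<close> vertices. The resulting bound does not depend on the order of
  \<open>G\<close>.\<close>

lemma expander_into_high_girth_small:
  fixes G :: "('a, 'b) pre_digraph" and H :: "('c, 'd) pre_digraph"
  assumes G: "graph G" and H: "graph H" and \<epsilon>: "0 < \<epsilon>" "\<epsilon> \<le> cheeger_constant G"
    and deg: "\<And>v. v \<in> verts H \<Longrightarrow> out_degree H v \<le> d"
    and lip: "\<And>x y. (x, y) \<in> arcs_ends G \<Longrightarrow> \<exists>j\<le>K. (\<psi> x, \<psi> y) \<in> arcs_ends H ^^ j"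
    and fib: "\<And>z. card {x \<in> verts G. \<psi> x = z} \<le> \<kappa>"
    and girth: "enat (2 * (K * card (arcs_ends G) + K) + 2) < girth H"
  shows "card (verts G) \<le> 2 * real \<kappa> + 2 * real d * (real (\<kappa> * (\<Sum>k\<le>K. d ^ k)) / \<epsilon>)"
proof (cases "card (verts G) \<le> 2 * \<kappa>")
  case True
  then have "real (card (verts G)) \<le> 2 * real \<kappa>" by linarith
  moreover have "0 \<le> 2 * real d * (real (\<kappa> * (\<Sum>k\<le>K. d ^ k)) / \<epsilon>)"
    using \<epsilon> by (intro mult_nonneg_nonneg divide_nonneg_pos) (auto simp del: of_nat_mult)
  ultimately show ?thesis by linarith
next
  case False
  interpret G: graph G by fact
  interpret H: graph H by fact
  let ?E = "arcs_ends H" and ?F = "arcs_ends G"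
  \<comment> \<open>The image of \<open>G\<close> lies within distance \<open>K * card ?F\<close> of
    the root; the extra \<open>K\<close> is the margin that \<open>balanced_separator\<close>
    requires.\<close>
  let ?R = "K * card ?F + K"
  have finF: "finite ?F"
    by (simp add: arcs_ends_def)
  obtain x0 where x0: "x0 \<in> verts G"
    using False by fastforce
  interpret tree_like_ball ?E "\<psi> x0" ?R
  proof
    show "sym ?E"
      using H.sym_arcs by (simp add: symmetric_def)
    show "irrefl ?E"
      using H.adj_not_same by (auto simp: irrefl_def)
    show "acyclic_upto (2 * ?R + 2) ?E"
      using H.wf_digraph girth by (rule acyclic_upto_if_less_girth)
  qed
  have nbrs: "?E `` {u} = head H ` out_arcs H u" for u
    by (auto simp: arcs_ends_conv)
  have deg': "finite (?E `` {u})" "card (?E `` {u}) \<le> d" for u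
  proof -
    show "finite (?E `` {u})"
      unfolding nbrs by (simp add: H.finite_out_arcs)
    have "card (?E `` {u}) \<le> out_degree H u"
      unfolding nbrs out_degree_def by (simp add: card_image_le H.finite_out_arcs)
    moreover have "out_arcs H u = {}" if "u \<notin> verts H"
      using that by auto
    ultimately show "card (?E `` {u}) \<le> d"
      using deg[of u] by (cases "u \<in> verts H") (auto simp: out_degree_def)
  qed
  \<comment> \<open>The number of arcs serves as a crude bound for the diameter of the connected
    graph \<open>G\<close>.\<close>
  have near: "\<exists>j\<le>K * card ?F. (\<psi> x0, \<psi> x) \<in> ?E ^^ j" if "x \<in> verts G" for x
  proof -
    have "(x0, x) \<in> ?F\<^sup>*"
      using G.connected_if_cheeger_pos[OF _ x0 that] \<epsilon> by linarith
    then obtain n where n: "n \<le> card ?F" "(x0, x) \<in> ?F ^^ n"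
      using rtrancl_finite_eq_relpow[OF finF] by auto
    then obtain j where "j \<le> K * n" "(\<psi> x0, \<psi> x) \<in> ?E ^^ j"
      using relpow_stretch[of ?F K \<psi> ?E, OF lip n(2)] by blast
    with n show ?thesis
      by (meson le_trans mult_le_mono2)
  qed
  have reach: "(\<psi> x0, \<psi> x) \<in> ?E\<^sup>*" "depth (\<psi> x) + K \<le> ?R" if "x \<in> verts G" for x
  proof -
    obtain j where j: "j \<le> K * card ?F" "(\<psi> x0, \<psi> x) \<in> ?E ^^ j"
      using near[OF \<open>x \<in> verts G\<close>] by blast
    then show "(\<psi> x0, \<psi> x) \<in> ?E\<^sup>*"
      by (auto simp: rtrancl_power)
    show "depth (\<psi> x) + K \<le> ?R"
      using depth_le[OF j(2)] j(1) by simp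
  qed
  obtain A where A: "A \<subseteq> verts G" "A \<noteq> {}" "2 * card A \<le> card (verts G)"
    "card (verts G) \<le> 2 * \<kappa> + 2 * d * card A"
    "card {y \<in> verts G - A. \<exists>x\<in>A. (x, y) \<in> ?F} \<le> \<kappa> * (\<Sum>k\<le>K. d ^ k)"
    by (rule balanced_separator[OF deg' G.finite_verts _ reach lip fib]) (use False in auto)
  have "\<epsilon> * card A \<le> card (vertex_boundary G A)"
    using G.cheeger_boundary[OF \<epsilon>(2) A(1-3)] .
  also have "\<dots> \<le> \<kappa> * (\<Sum>k\<le>K. d ^ k)"
    using A(5) unfolding vertex_boundary_def by (rule of_nat_mono)
  finally have "card A \<le> real (\<kappa> * (\<Sum>k\<le>K. d ^ k)) / \<epsilon>"
    using \<epsilon> by (simp add: field_simps)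
  then have "2 * real d * card A \<le> 2 * real d * (real (\<kappa> * (\<Sum>k\<le>K. d ^ k)) / \<epsilon>)"
    by (intro mult_left_mono) auto
  moreover have "real (card (verts G)) \<le> 2 * real \<kappa> + 2 * real d * card A"
    using of_nat_mono[OF A(4), where ?'a = real] by simp
  ultimately show ?thesis by linarith
qed

section \<open>A sparse subsequence and a family of index sets\<close>

text \<open>Growth is arranged between consecutive terms only. It extends to all
  \<open>i < j\<close> because \<open>c n \<le> X n\<close> makes \<open>X (f j)\<close>
  nondecreasing and \<open>P\<close> passes to smaller thresholds. The factor \<open>j\<close> later
  absorbs the constants of a regular map.\<close>

lemma fast_growing_subsequence:
  fixes c X :: "nat \<Rightarrow> nat"
  assumes ex: "\<And>C. \<exists>n. C < c n \<and> P C n" and "\<And>n. c n \<le> X n"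
    and mono: "\<And>n. antimono (\<lambda>C. P C n)"
  obtains f :: "nat \<Rightarrow> nat" where "\<And>i j. i < j \<Longrightarrow> j * X (f i) < c (f j) \<and> P (j * X (f i)) (f j)"
proof -
  obtain g where g: "\<And>C. C < c (g C) \<and> P C (g C)"
    using ex by metis
  define f where "f = rec_nat (g 0) (\<lambda>j n. g (Suc j * X n))"
  have f: "Suc j * X (f j) < c (f (Suc j))" "P (Suc j * X (f j)) (f (Suc j))" for j
    using g[of "Suc j * X (f j)"] by (simp_all add: f_def)
  have "X (f j) \<le> X (f (Suc j))" for j
    using f(1)[of j] assms(2)[of "f (Suc j)"] by simp
  then have X: "X (f i) \<le> X (f j)" if "i \<le> j" for i j
    using that by (rule lift_Suc_mono_le[of "\<lambda>j. X (f j)"])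
  show thesis
  proof (rule that)
    fix i j :: nat
    assume "i < j"
    then obtain l where l: "j = Suc l" "i \<le> l"
      by (metis Suc_leI Suc_le_D Suc_le_mono)
    have "j * X (f i) \<le> Suc l * X (f l)"
      unfolding l(1) using X[OF l(2)] by (rule mult_le_mono2)
    moreover from this have "P (Suc l * X (f l)) n \<Longrightarrow> P (j * X (f i)) n" for n
      using antimonoD[OF mono] by (blast dest: le_boolD)
    ultimately show "j * X (f i) < c (f j) \<and> P (j * X (f i)) (f j)"
      using f[of l] l(1) by simp
  qed
qed

text \<open>The parity of the second coordinate records membership of \<open>x\<close>, so different
  sets \<open>S\<close> leave elements on both sides. The free coordinate \<open>k\<close> repeats
  each record infinitely often, beyond every bound.\<close>

definition index_set :: "nat set \<Rightarrow> nat set" where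
  "index_set S = {prod_encode (k, 2 * x + of_bool (x \<in> S)) | k x. True}"

lemma infinite_index_set: "infinite (index_set S)"
proof -
  have "prod_encode (k, of_bool (0 \<in> S)) \<in> index_set S" for k
    unfolding index_set_def by (intro CollectI exI[of _ k] exI[of _ 0]) simp
  then have "range (\<lambda>k. prod_encode (k, of_bool (0 \<in> S))) \<subseteq> index_set S"
    by blast
  moreover have "inj (\<lambda>k. prod_encode (k, of_bool (0 \<in> S)))"
    by (auto simp: inj_def)
  ultimately show ?thesis
    using finite_subset range_inj_infinite by blast
qed

text \<open>At a point \<open>x\<close> where \<open>S\<close> and \<open>T\<close> disagree,
  \<open>t\<close> carries the bit of \<open>S\<close>, whichever of the two sets contains
  \<open>x\<close>.\<close>

lemma index_set_separation:
  assumes "S \<noteq> T"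
  obtains t where "\<And>k. prod_encode (k, t) \<in> index_set S" "\<And>k. prod_encode (k, t) \<notin> index_set T"
proof -
  obtain x where x: "(x \<in> S) \<noteq> (x \<in> T)"
    using assms by blast
  show thesis
  proof (rule that)
    show "prod_encode (k, 2 * x + of_bool (x \<in> S)) \<in> index_set S" for k
      unfolding index_set_def by blast
    have "2 * x + of_bool (x \<in> S) \<noteq> 2 * y + of_bool (y \<in> T)" for y
    proof
      assume eq: "2 * x + of_bool (x \<in> S) = 2 * y + of_bool (y \<in> T)"
      have "x = y"
        using arg_cong[OF eq, of "\<lambda>n. n div 2"] by (cases "x \<in> S"; cases "y \<in> T") auto
      with eq x show False
        by auto
    qed
    then show "prod_encode (k, 2 * x + of_bool (x \<in> S)) \<notin> index_set T" for k
      by (auto simp: index_set_def)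
  qed
qed

section \<open>Continuum many unions without regular maps between them\<close>

theorem mainTheorem2:
  fixes d :: nat and \<epsilon> :: real and \<Gamma> :: "nat \<Rightarrow> ('a, 'b) pre_digraph"
  assumes "\<epsilon> > 0"
    and "bounded_degree_expander d \<epsilon> \<Gamma>"
    and "unbounded_girth \<Gamma>"
  shows "\<exists>\<N> :: nat set set.
           \<N> \<approx> (UNIV :: nat set set) \<and>
           (\<forall>N \<in> \<N>. infinite N) \<and>
           (\<forall>M \<in> \<N>. \<forall>N \<in> \<N>. M \<noteq> N \<longrightarrow>
              (\<nexists>\<phi>. regular_map (disjoint_union M \<Gamma>) (disjoint_union N \<Gamma>) \<phi>))"
proof -
  have graph: "\<And>n. graph (\<Gamma> n)" and cheeger: "\<And>n. \<epsilon> \<le> cheeger_constant (\<Gamma> n)"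
    and two: "\<And>n. 2 \<le> card (verts (\<Gamma> n))"
    and noniso: "\<And>m n. m \<noteq> n \<Longrightarrow> \<not> digraph_iso (\<Gamma> m) (\<Gamma> n)"
    and deg: "\<And>n v. v \<in> verts (\<Gamma> n) \<Longrightarrow> out_degree (\<Gamma> n) v \<le> d"
    using assms(2) by (auto simp: bounded_degree_expander_def expander_def)
  have fin: "finite (verts (\<Gamma> n))" for n
    using graph[of n] by (simp add: graph_def digraph_def fin_digraph.finite_verts)
  \<comment> \<open>The first two summands serve the girth bound needed when the target has the
    larger index, the last one the fibre count when it has the smaller index.\<close>
  define X where "X n = 2 * card (arcs_ends (\<Gamma> n)) + 4 + card (verts (\<Gamma> n))" for n
  have ex: "\<exists>n. C < card (verts (\<Gamma> n)) \<and> enat C < girth (\<Gamma> n)" for C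
  proof -
    have "\<forall>\<^sub>F n in sequentially. enat C < girth (\<Gamma> n)"
      using assms(3) unfolding unbounded_girth_def by (rule order_tendstoD) simp
    moreover have "\<forall>\<^sub>F n in sequentially. C < card (verts (\<Gamma> n))"
      using finite_small_nonisomorphic_graphs[of \<Gamma> C] graph noniso
      by (simp add: cofinite_eq_sequentially[symmetric] eventually_cofinite not_less)
    ultimately have "\<forall>\<^sub>F n in sequentially. C < card (verts (\<Gamma> n)) \<and> enat C < girth (\<Gamma> n)"
      by (rule eventually_conj[rotated])
    then show ?thesis
      using eventually_happens'[OF sequentially_bot] by blast
  qed
  have le_X: "card (verts (\<Gamma> n)) \<le> X n" for n
    by (simp add: X_def)
  have mono: "antimono (\<lambda>C. enat C < girth (\<Gamma> n))" for n
    by (intro antimonoI le_boolI) (meson enat_ord_simps(1) order_le_less_trans)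
  obtain f where f: "\<And>i j. i < j \<Longrightarrow>
      j * X (f i) < card (verts (\<Gamma> (f j))) \<and> enat (j * X (f i)) < girth (\<Gamma> (f j))"
    using fast_growing_subsequence[of "\<lambda>n. card (verts (\<Gamma> n))" "\<lambda>C n. enat C < girth (\<Gamma> n)" X,
        OF ex le_X mono] by blast
  have large: "i < card (verts (\<Gamma> (f i)))" for i
  proof (cases "i = 0")
    case True
    then show ?thesis using two[of "f i"] by simp
  next
    case False
    then have "i * X (f 0) < card (verts (\<Gamma> (f i)))"
      using f[of 0 i] by simp
    moreover have "i \<le> i * X (f 0)"
      by (simp add: X_def)
    ultimately show ?thesis
      by (rule order_le_less_trans[rotated])
  qed
  have "inj f"
  proof (rule linorder_injI)
    fix i j :: nat
    assume "i < j"
    moreover have "card (verts (\<Gamma> (f i))) \<le> j * X (f i)"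
      using \<open>i < j\<close> by (cases j) (auto simp: X_def)
    ultimately show "f i \<noteq> f j"
      using f[of i j] by auto
  qed
  define \<S> where "\<S> S = f ` index_set S" for S
  have no_map: "\<not> regular_map (disjoint_union (\<S> S) \<Gamma>) (disjoint_union (\<S> T) \<Gamma>) \<phi>"
    if "S \<noteq> T" for S T \<phi>
  proof
    assume reg: "regular_map (disjoint_union (\<S> S) \<Gamma>) (disjoint_union (\<S> T) \<Gamma>) \<phi>"
    have pos: "0 < cheeger_constant (\<Gamma> n)" for n
      using cheeger[of n] assms(1) by linarith
    have ne: "verts (\<Gamma> n) \<noteq> {}" for n
      using two[of n] by auto
    obtain K \<kappa> :: nat where map: "\<forall>n\<in>\<S> S. \<exists>m\<in>\<S> T. \<exists>\<psi>. \<psi> \<in> verts (\<Gamma> n) \<rightarrow> verts (\<Gamma> m) \<and>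
      (\<forall>x y. (x, y) \<in> arcs_ends (\<Gamma> n) \<longrightarrow> (\<exists>j\<le>K. (\<psi> x, \<psi> y) \<in> arcs_ends (\<Gamma> m) ^^ j)) \<and>
      (\<forall>z. card {x \<in> verts (\<Gamma> n). \<psi> x = z} \<le> \<kappa>)"
      by (rule regular_map_on_components[OF graph pos ne reg])
    define B where "B = 2 * real \<kappa> + 2 * real d * (real (\<kappa> * (\<Sum>k\<le>K. d ^ k)) / \<epsilon>)"
    obtain t where t: "\<And>k. prod_encode (k, t) \<in> index_set S"
        "\<And>k. prod_encode (k, t) \<notin> index_set T"
      using index_set_separation[OF \<open>S \<noteq> T\<close>] by blast
    \<comment> \<open>The first coordinate is chosen after the regular map, so that \<open>i\<close>
      exceeds its constants and the bound \<open>B\<close>.\<close>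
    define i where "i = prod_encode (K + \<kappa> + nat \<lceil>B\<rceil>, t)"
    have "K + \<kappa> + nat \<lceil>B\<rceil> \<le> i"
      unfolding i_def by (rule le_prod_encode_1)
    then have i: "K \<le> i" "\<kappa> \<le> i" "B \<le> real i"
      by linarith+
    have "f i \<in> \<S> S"
      using t(1) by (simp add: \<S>_def i_def)
    from map[THEN bspec, OF this] obtain j \<psi> where j: "j \<in> index_set T"
      and \<psi>: "\<psi> \<in> verts (\<Gamma> (f i)) \<rightarrow> verts (\<Gamma> (f j))"
      and lip: "\<And>x y. (x, y) \<in> arcs_ends (\<Gamma> (f i)) \<Longrightarrow> \<exists>l\<le>K. (\<psi> x, \<psi> y) \<in> arcs_ends (\<Gamma> (f j)) ^^ l"
      and fib: "\<And>z. card {x \<in> verts (\<Gamma> (f i)). \<psi> x = z} \<le> \<kappa>"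
      unfolding \<S>_def by blast
    \<comment> \<open>Equality is impossible, since \<open>i\<close> is not in
      \<open>index_set T\<close>.\<close>
    consider "i < j" | "j < i"
      using j t(2) unfolding i_def by (metis linorder_neqE_nat)
    then show False
    proof cases
      case 1
      let ?D = "card (arcs_ends (\<Gamma> (f i)))"
      \<comment> \<open>Used with \<open>a = K * ?D\<close> and \<open>b = j * ?D\<close>; it holds
        because \<open>K \<le> i < j\<close>.\<close>
      have "2 * (a + K) + 2 \<le> 2 * b + 4 * j" if "a \<le> b" for a b :: nat
        using that i(1) 1 by simp
      moreover have "K * ?D \<le> j * ?D"
        using i 1 by simp
      ultimately have "2 * (K * ?D + K) + 2 \<le> 2 * (j * ?D) + 4 * j" .
      also have "\<dots> \<le> j * X (f i)"
        by (simp add: X_def algebra_simps)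
      finally have girth: "enat (2 * (K * ?D + K) + 2) < girth (\<Gamma> (f j))"
        using f[OF 1] by (meson enat_ord_simps(1) order_le_less_trans)
      have "card (verts (\<Gamma> (f i))) \<le> B"
        unfolding B_def
        by (rule expander_into_high_girth_small[OF graph graph assms(1) cheeger deg lip fib girth])
      with i large[of i] show False
        by linarith
    next
      case 2
      \<comment> \<open>The fibres cover the whole of the larger graph, but there are too few of
        them and each is too small.\<close>
      have "verts (\<Gamma> (f i)) = {x \<in> verts (\<Gamma> (f i)). \<psi> x \<in> verts (\<Gamma> (f j))}"
        using \<psi> by auto
      also have "card \<dots> \<le> \<kappa> * card (verts (\<Gamma> (f j)))"
        using fin fib by (intro card_vimage_le)
      also have "\<dots> \<le> i * X (f j)"
        using i by (intro mult_le_mono) (auto simp: X_def)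
      finally show False
        using f[OF 2] by simp
    qed
  qed
  have "S = T" if "\<S> S = \<S> T" for S T
  proof (rule ccontr)
    assume "S \<noteq> T"
    then obtain t where "prod_encode (0, t) \<in> index_set S" "prod_encode (0, t) \<notin> index_set T"
      using index_set_separation by metis
    moreover have "index_set S = index_set T"
      using that \<open>inj f\<close> by (simp add: \<S>_def inj_image_eq_iff)
    ultimately show False by simp
  qed
  then have "inj \<S>"
    by (rule injI)
  then have "range \<S> \<approx> (UNIV :: nat set set)"
    by (rule inj_on_image_eqpoll_self)
  moreover have "infinite (\<S> S)" for S
    using infinite_index_set[of S] \<open>inj f\<close>
    by (simp add: \<S>_def finite_image_iff inj_on_subset[OF _ subset_UNIV])
  moreover have "\<nexists>\<phi>. regular_map (disjoint_union M \<Gamma>) (disjoint_union N \<Gamma>) \<phi>"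
    if MN: "M \<in> range \<S>" "N \<in> range \<S>" "M \<noteq> N" for M N
  proof -
    obtain S T where "M = \<S> S" "N = \<S> T"
      using MN(1,2) by blast
    with MN(3) no_map[of S T] show ?thesis
      by auto
  qed
  ultimately show ?thesis
    by (intro exI[of _ "range \<S>"] conjI ballI impI) auto
qed

end
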